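(* Let $0<\alpha<1$. Assume that the heat kernel satisfies, for some constant $C>0$, $$0<p_s(x,y)\lesssim \frac{1}{\mu(B(x,\sqrt s))}e^{-C d(x,y)^2/s}\qquad\text{for all } s>0,\ x,y\in\mathbb M,$$ and that the measure $\mu$ satisfies the lower density condition $$\inf_{(x,r)\in\mathbb M\times(0,\infty)}\frac{\mu(B(x,r))}{r^{\beta^\star}}>0 .$$ Then for all $(x,y,t)\in\mathbb M\times\mathbb M\times(0,\infty)$, $$K^{\mathcal L}_{\alpha,t}(x,y)\lesssim \min\Big\{t^{-\beta^\star/2\alpha},\ \frac{t}{d(x,y)^{\beta^\star+2\alpha}}\Big\}\lesssim \frac{t}{(t^{1/2\alpha}+d(x,y))^{\beta^\star+2\alpha}} .$$
   Context: Setting: $(\mathbb M,d,\mu)$ is a metric measure space, i.e. $(\mathbb M,d)$ is a non-empty, locally compact, separable metric space and $\mu$ is a Borel measure on $\mathbb M$; $B(x,r)=\{y\in\mathbb M: d(x,y)<r\}$. $\beta^\star$ is a positive constant less than or equal to the Hausdorff dimension of $\mathbb M$. Heat kernel: a family $\{p_t\}_{t>0}$ of measurable functions on $\mathbb M\times\mathbb M$ such that for almost all $x,y\in\mathbb M$ and all $s,t>0$: (i) $p_t(x,y)\ge0$; (ii) $\int_{\mathbb M}p_t(x,y)\,d\mu(y)\le1$; (iii) $p_t(x,y)=p_t(y,x)$; (iv) $p_{s+t}(x,y)=\int_{\mathbb M}p_s(x,z)p_t(z,y)\,d\mu(z)$; (v) $\lim_{t\to0^+}\int_{\mathbb M}p_t(x,y)f(y)\,d\mu(y)=f(x)$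 for all $f\in L^2(\mathbb M,\mu)$. It generates the semigroup $P_tf(x)=\int_{\mathbb M}p_t(x,y)f(y)\,d\mu(y)$ on $L^2(\mathbb M,\mu)$, with generator $\mathcal Lf=\lim_{t\to0}(f-P_tf)/t$ (limit in $L^2$), a self-adjoint, positive definite operator, so $P_t=e^{-t\mathcal L}$. Fractional heat kernel: for $0<\alpha<1$, the integral kernel of $e^{-t\mathcal L^\alpha}$ is $K^{\mathcal L}_{\alpha,t}(x,y)=\int_0^\infty\eta^\alpha_t(s)p_s(x,y)\,ds$, where $\eta^\alpha_t$ is the non-negative continuous subordination density, satisfying $\eta^\alpha_t(s)=t^{-1/\alpha}\eta^\alpha_1(s/t^{1/\alpha})$; $\eta^\alpha_t(s)\lesssim t/s^{1+\alpha}$ for all $s,t>0$; $\int_0^\infty s^{-\gamma}\eta^\alpha_1(s)\,ds<\infty$ for $\gamma>0$; $\eta^\alpha_t(s)\simeq t/s^{1+\alpha}$ for $s\ge t^{1/\alpha}>0$. $X\lesssim Y$ means $X\le cY$ with a constant $c>0$ independent of the variables ($x,y,s,t$). When $d(x,y)=0$ the second entry of the minimum is read as $+\infty$. *)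

theory Defs
  imports "HOL-Analysis.Analysis"
begin

locale metric_measure_space =
  fixes M :: "'a::metric_space measure"
  assumes sets_eq_borel: "sets M = sets borel"
    and separable: "separable_space (euclidean :: 'a topology)"
    and locally_compact: "locally_compact_space (euclidean :: 'a topology)"

text \<open>
  Hausdorff measure and dimension. Covering sets are required to be bounded because
  \<^const>\<open>diameter\<close> is only meaningful for bounded sets. The exponent zero is left out of the
  infimum defining the dimension: this does not change its value and avoids the convention for
  \<open>0 powr 0\<close>. The infimum of the empty set is \<open>\<infinity>\<close>.
\<close>

definition hausdorff_premeasure :: "real \<Rightarrow> real \<Rightarrow> 'a::metric_space set \<Rightarrow> ennreal" where
  "hausdorff_premeasure s \<delta> A =
     (INF U \<in> {U :: nat \<Rightarrow> 'a set. A \<subseteq> (\<Union>i. U i) \<and> (\<forall>i. bounded (U i) \<and> diameter (U i) \<le> \<delta>)}.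
        (\<Sum>i. ennreal (diameter (U i) powr s)))"

definition hausdorff_measure :: "real \<Rightarrow> 'a::metric_space set \<Rightarrow> ennreal" where
  "hausdorff_measure s A = (SUP \<delta> \<in> {0<..}. hausdorff_premeasure s \<delta> A)"

definition hausdorff_dim :: "'a::metric_space set \<Rightarrow> ennreal" where
  "hausdorff_dim A = Inf {ennreal s | s. s > 0 \<and> hausdorff_measure s A = 0}"

text \<open>
  The exceptional null sets may depend on the times and, in the last condition, on the
  representative \<open>f\<close> of an element of \<open>L\<^sup>2\<close> (where this is unavoidable). ``Almost all \<open>x, y\<close>'' is
  an iterated quantifier, so that no \<open>\<sigma>\<close>-finiteness is needed to form a product measure.
\<close>

locale heat_kernel = metric_measure_space M
  for M :: "'a::metric_space measure" +
  fixes p :: "real \<Rightarrow> 'a \<Rightarrow> 'a \<Rightarrow> real"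
  assumes measurable:
      "\<And>t. t > 0 \<Longrightarrow> (\<lambda>(x, y). p t x y) \<in> borel_measurable (M \<Otimes>\<^sub>M M)"
    and nonneg:
      "\<And>t. t > 0 \<Longrightarrow> AE x in M. AE y in M. 0 \<le> p t x y"
    and sub_markov:
      "\<And>t. t > 0 \<Longrightarrow> AE x in M. (\<integral>\<^sup>+ y. ennreal (p t x y) \<partial>M) \<le> 1"
    and symmetric:
      "\<And>t. t > 0 \<Longrightarrow> AE x in M. AE y in M. p t x y = p t y x"
    and semigroup:
      "\<And>s t. s > 0 \<Longrightarrow> t > 0 \<Longrightarrow>
         AE x in M. AE y in M. ennreal (p (s + t) x y) = (\<integral>\<^sup>+ z. ennreal (p s x z * p t z y) \<partial>M)"
    and approx_identity:
      "\<And>f :: 'a \<Rightarrow> real. f \<in> borel_measurable M \<Longrightarrow> integrable M (\<lambda>x. (f x)\<^sup>2) \<Longrightarrow>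
         AE x in M. ((\<lambda>t. LINT y|M. p t x y * f y) \<longlongrightarrow> f x) (at_right 0)"

text \<open>
  The density of the \<open>\<alpha>\<close>-stable subordinator, i.e. the non-negative continuous function with
  \<open>exp (- t * l powr \<alpha>) = \<integral>\<^sub>0\<^sup>\<infinity> exp (- l * s) * \<eta> t s ds\<close>. By uniqueness of Laplace transforms
  this determines \<open>\<eta> t s\<close> for all \<open>t, s > 0\<close>. The scaling relation, the two-sided bounds by
  \<open>t / s powr (1 + \<alpha>)\<close> and the finiteness of the negative moments are properties of this
  function and are not assumed separately.
\<close>

definition subordination_density :: "real \<Rightarrow> (real \<Rightarrow> real \<Rightarrow> real) \<Rightarrow> bool" where
  "subordination_density \<alpha> \<eta> \<longleftrightarrow>
     (\<forall>t>0. continuous_on {0<..} (\<eta> t) \<and> (\<forall>s>0. 0 \<le> \<eta> t s) \<and>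
       (\<forall>l\<ge>0. (\<integral>\<^sup>+ s \<in> {0<..}. ennreal (exp (- l * s) * \<eta> t s) \<partial>lborel)
                = ennreal (exp (- t * l powr \<alpha>))))"

text \<open>
  For \<open>P\<^sub>s = exp (- s L)\<close> with kernel \<open>p s\<close>, integrating the Laplace transform identity over the
  spectrum of \<open>L\<close> gives the kernel of \<open>exp (- t L\<^sup>\<alpha>)\<close>. The integral of this non-negative
  function is taken in \<^typ>\<open>ennreal\<close>, so an upper bound includes its finiteness.
\<close>

definition fractional_heat_kernel ::
  "(real \<Rightarrow> real \<Rightarrow> real) \<Rightarrow> (real \<Rightarrow> 'a \<Rightarrow> 'a \<Rightarrow> real) \<Rightarrow> real \<Rightarrow> 'a \<Rightarrow> 'a \<Rightarrow> ennreal" where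
  "fractional_heat_kernel \<eta> p t x y = (\<integral>\<^sup>+ s \<in> {0<..}. ennreal (\<eta> t s * p s x y) \<partial>lborel)"

text \<open>
  In \<^typ>\<open>ennreal\<close> division by zero of a nonzero element is \<open>\<infinity>\<close>, so for \<open>dist x y = 0\<close> and
  \<open>t > 0\<close> the second entry of the minimum is \<open>\<infinity>\<close>.
\<close>

definition fractional_min_bound ::
  "real \<Rightarrow> real \<Rightarrow> real \<Rightarrow> 'a::metric_space \<Rightarrow> 'a \<Rightarrow> ennreal" where
  "fractional_min_bound \<alpha> \<beta> t x y =
     min (ennreal (t powr (- \<beta> / (2 * \<alpha>))))
         (ennreal t / ennreal (dist x y powr (\<beta> + 2 * \<alpha>)))"

end

theory Submission
  imports Defs
begin

text \<open>
  The lower density condition turns the Gaussian bound into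
  \<open>p s x y \<le> A * s powr (-\<beta>/2) * exp (-C d\<^sup>2/s)\<close> with \<open>d = dist x y\<close>, so it remains to integrate
  this function of \<open>s\<close> against the subordination density \<open>\<eta> t\<close>. In both regimes it is dominated by
  a function whose integral is read off from the Laplace transform \<open>exp (-t l\<^sup>\<alpha>)\<close> of \<open>\<eta> t\<close>.

  \<^item> For the bound \<open>t powr (-\<beta>/2\<alpha>)\<close> the exponential is dropped. Up to a constant,
    \<open>s powr (-\<gamma>)\<close> is at most \<open>\<integral>\<^sub>0\<^sup>\<infinity> l powr (\<gamma>-1) * exp (-l s) dl\<close>, so by Tonelli the negative
    moment of \<open>\<eta> t\<close> is at most \<open>\<integral>\<^sub>0\<^sup>\<infinity> l powr (\<gamma>-1) * exp (-t l\<^sup>\<alpha>) dl\<close>, which is of order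
    \<open>t powr (-\<gamma>/\<alpha>)\<close> (lemma \<open>subordination_negative_moment\<close>); \<open>\<gamma> = \<beta>/2\<close> is used.
  \<^item> For the bound \<open>t / d powr (\<beta>+2\<alpha>)\<close> a single Laplace parameter suffices. In the scaled
    variable \<open>\<sigma> = s/d\<^sup>2\<close> the function \<open>\<sigma> powr (-\<beta>/2) * exp (-C/\<sigma>)\<close> vanishes rapidly at \<open>0\<close> and is
    bounded at \<open>\<infinity>\<close>, hence is dominated by \<open>1 - exp (-\<sigma>)\<close> (lemma
    \<open>gaussian_le_one_minus_exp\<close>). Integrating against \<open>\<eta> t\<close> gives \<open>1 - exp (-t l\<^sup>\<alpha>) \<le> t l\<^sup>\<alpha>\<close> with
    \<open>l = 1/d\<^sup>2\<close> (lemma \<open>subordination_one_minus_laplace_le\<close>), which is \<open>t / d powr (2\<alpha>)\<close>; the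
    missing factor \<open>d powr (-\<beta>)\<close> comes from the scaling.

  The second inequality only compares \<open>t powr (1/2\<alpha>) + d\<close> with twice the larger summand.
\<close>

section \<open>Elementary estimates\<close>

text \<open>The inequality \<open>u \<le> exp u\<close> at \<open>u = b x / a\<close>, raised to the power \<open>a\<close>.\<close>
lemma powr_le_exp:
  fixes x a b :: real
  assumes "0 \<le> x" "0 < a" "0 < b"
  shows "x powr a \<le> (a / b) powr a * exp (b * x)"
proof -
  have "b * x / a \<le> exp (b * x / a)"
    using exp_ge_add_one_self[of "b * x / a"] by linarith
  then have "(b * x / a) powr a \<le> exp (b * x / a) powr a"
    using assms by (intro powr_mono2) auto
  also have "\<dots> = exp (b * x)"
    using assms by (simp add: exp_powr_real)
  finally have "(a / b) powr a * (b * x / a) powr a \<le> (a / b) powr a * exp (b * x)"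
    by (intro mult_left_mono) auto
  moreover have "(a / b) powr a * (b * x / a) powr a = x powr a"
    using assms by (simp flip: powr_mult)
  ultimately show ?thesis by simp
qed

lemma ennreal_inverse_antimono:
  fixes u v :: ennreal
  assumes "u \<le> v"
  shows "inverse v \<le> inverse u"
proof (cases "u = 0 \<or> v = top")
  case False
  with assms have "0 < u" "u < top" "0 < v" "v < top"
    by (auto simp: top_unique less_top zero_less_iff_neq_zero)
  then obtain r q where rq: "u = ennreal r" "v = ennreal q" "r > 0" "q > 0"
    by (metis ennreal_cases ennreal_less_zero_iff less_irrefl)
  with assms have "r \<le> q" by simp
  with rq show ?thesis
    by (simp add: inverse_ennreal ennreal_leI)
qed auto

section \<open>The Laplace transform of the subordination density\<close>

lemma subordination_density_measurable:
  assumes "subordination_density \<alpha> \<eta>" "t > 0"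
  shows "(\<lambda>s. ennreal (\<eta> t s) * indicator {0<..} s) \<in> borel_measurable borel"
proof -
  have "continuous_on {0<..} (\<eta> t)"
    using assms by (auto simp: subordination_density_def)
  then have "(\<lambda>s. indicator {0<..} s *\<^sub>R \<eta> t s) \<in> borel_measurable borel"
    by (intro borel_measurable_continuous_on_indicator) auto
  then have "(\<lambda>s. ennreal (indicator {0<..} s *\<^sub>R \<eta> t s)) \<in> borel_measurable borel"
    by measurable
  also have "(\<lambda>s. ennreal (indicator {0<..} s *\<^sub>R \<eta> t s)) = (\<lambda>s. ennreal (\<eta> t s) * indicator {0<..} s)"
    by (auto simp: indicator_def)
  finally show ?thesis .
qed

lemma subordination_laplace:
  assumes "subordination_density \<alpha> \<eta>" "t > 0" "l \<ge> 0"
  shows "(\<integral>\<^sup>+ s. ennreal (exp (- l * s)) * (ennreal (\<eta> t s) * indicator {0<..} s) \<partial>lborel)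
           = ennreal (exp (- t * l powr \<alpha>))"
proof -
  have "(\<integral>\<^sup>+ s. ennreal (exp (- l * s)) * (ennreal (\<eta> t s) * indicator {0<..} s) \<partial>lborel)
        = (\<integral>\<^sup>+ s \<in> {0<..}. ennreal (exp (- l * s) * \<eta> t s) \<partial>lborel)"
    using assms
    by (intro nn_integral_cong) (auto simp: indicator_def subordination_density_def ennreal_mult)
  then show ?thesis
    using assms by (auto simp: subordination_density_def)
qed

text \<open>
  As \<open>1 - exp (-l s)\<close> is bounded below for \<open>s \<ge> 1/l\<close>, this controls the mass that \<open>\<eta> t\<close> puts on large
  \<open>s\<close>: an integrated form of the tail behaviour \<open>t / s powr (1 + \<alpha>)\<close>. The difference of
  the Laplace transforms at \<open>0\<close> and at \<open>l\<close> is \<open>1 - exp (-t l\<^sup>\<alpha>)\<close>, and \<open>1 - u \<le> exp (-u)\<close>.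
\<close>
lemma subordination_one_minus_laplace_le:
  assumes \<eta>: "subordination_density \<alpha> \<eta>" and "t > 0" "l \<ge> 0"
  shows "(\<integral>\<^sup>+ s. ennreal (1 - exp (- l * s)) * (ennreal (\<eta> t s) * indicator {0<..} s) \<partial>lborel)
           \<le> ennreal (t * l powr \<alpha>)" (is "?I \<le> _")
proof -
  note [measurable] = subordination_density_measurable[OF \<eta> \<open>t > 0\<close>]
  let ?w = "\<lambda>s. ennreal (\<eta> t s) * indicator {0<..} s"
  have "ennreal (exp (- t * l powr \<alpha>)) + ?I
      = (\<integral>\<^sup>+ s. ennreal (exp (- l * s)) * ?w s + ennreal (1 - exp (- l * s)) * ?w s \<partial>lborel)"
    by (subst nn_integral_add) (simp_all add: subordination_laplace[OF \<eta> \<open>t > 0\<close> \<open>l \<ge> 0\<close>, simplified])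
  also have "\<dots> = (\<integral>\<^sup>+ s. ennreal (exp (- 0 * s)) * ?w s \<partial>lborel)"
    using \<open>l \<ge> 0\<close>
    by (intro nn_integral_cong)
       (auto simp: indicator_def ennreal_plus[symmetric] distrib_right[symmetric] simp del: ennreal_plus)
  also have "\<dots> = 1"
    using subordination_laplace[OF \<eta> \<open>t > 0\<close>, of 0] by simp
  finally have *: "ennreal (exp (- t * l powr \<alpha>)) + ?I = 1" .
  then have "?I \<noteq> top" by auto
  then obtain r where r: "?I = ennreal r" "r \<ge> 0" by (cases ?I) auto
  with * have "exp (- t * l powr \<alpha>) + r = 1"
    by (simp flip: ennreal_plus)
  moreover have "1 + (- t * l powr \<alpha>) \<le> exp (- t * l powr \<alpha>)"
    by (rule exp_ge_add_one_self)
  ultimately show ?thesis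
    unfolding r by (intro ennreal_leI) linarith
qed

section \<open>Negative moments of the subordination density\<close>

lemma nn_integral_powr_from_0:
  fixes a c :: real
  assumes "a > 0" "c \<ge> 0"
  shows "(\<integral>\<^sup>+ l. ennreal (l powr (a - 1)) * indicator {0..c} l \<partial>lborel) = ennreal (c powr a / a)"
  using has_integral_powr_from_0[of "a - 1" c] assms
  by (intro nn_integral_has_integral_lebesgue') auto

lemma nn_integral_powr_to_inf:
  fixes a c :: real
  assumes "a > 0" "c > 0"
  shows "(\<integral>\<^sup>+ l. ennreal (l powr (- a - 1)) * indicator {c..} l \<partial>lborel) = ennreal (c powr (- a) / a)"
  using has_integral_powr_to_inf[of "- a - 1" c] assms
  by (intro nn_integral_has_integral_lebesgue') auto

text \<open>
  The right-hand integral equals \<open>Gamma \<gamma> * s powr (-\<gamma>)\<close>. A lower bound of this order is enough,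
  and integrating only over \<open>l \<le> 1/s\<close>, where \<open>exp (-l s) \<ge> exp (-1)\<close>, already provides one.
\<close>
lemma powr_minus_le_nn_integral_exp:
  fixes s \<gamma> :: real
  assumes "s > 0" "\<gamma> > 0"
  shows "ennreal (s powr (- \<gamma>)) \<le> ennreal (exp 1 * \<gamma>) *
           (\<integral>\<^sup>+ l. ennreal (l powr (\<gamma> - 1)) * indicator {0..} l * ennreal (exp (- l * s)) \<partial>lborel)"
proof -
  have eq: "ennreal (s powr (- \<gamma>)) = ennreal (exp 1 * \<gamma>) * (ennreal (exp (- 1)) * ennreal ((1 / s) powr \<gamma> / \<gamma>))"
    using assms by (simp add: ennreal_mult[symmetric] exp_minus powr_minus powr_divide field_simps)
  have "ennreal (exp (- 1)) * ennreal ((1 / s) powr \<gamma> / \<gamma>)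
     = (\<integral>\<^sup>+ l. ennreal (exp (- 1)) * (ennreal (l powr (\<gamma> - 1)) * indicator {0..1/s} l) \<partial>lborel)"
    using assms by (subst nn_integral_cmult) (simp_all add: nn_integral_powr_from_0)
  also have "\<dots> \<le> (\<integral>\<^sup>+ l. ennreal (l powr (\<gamma> - 1)) * indicator {0..} l * ennreal (exp (- l * s)) \<partial>lborel)"
    using assms
    by (intro nn_integral_mono)
       (auto simp: indicator_def field_simps ennreal_mult[symmetric] intro!: ennreal_leI mult_right_mono)
  finally show ?thesis unfolding eq by (rule mult_left_mono) simp
qed

text \<open>
  The exponential cuts the integral off at \<open>L = t powr (-1/\<alpha>)\<close>. Below \<open>L\<close> it is bounded by \<open>1\<close>, above
  \<open>L\<close> by a negative power of \<open>t l\<^sup>\<alpha>\<close>; both parts are of order \<open>L\<^sup>\<gamma>\<close>.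
\<close>
lemma nn_integral_powr_exp_powr_le:
  fixes \<gamma> \<alpha> t :: real
  assumes "\<gamma> > 0" "\<alpha> > 0" "t > 0"
  shows "(\<integral>\<^sup>+ l. ennreal (l powr (\<gamma> - 1)) * indicator {0..} l * ennreal (exp (- t * l powr \<alpha>)) \<partial>lborel)
      \<le> ennreal ((1 + (2 * \<gamma> / \<alpha>) powr (2 * \<gamma> / \<alpha>)) / \<gamma> * t powr (- \<gamma> / \<alpha>))"
proof -
  \<comment> \<open>The exponent \<open>N\<close> makes \<open>(t l\<^sup>\<alpha>) powr (-N)\<close> proportional to \<open>l powr (-2\<gamma>)\<close>, so that the integrand
      above \<open>L\<close> decays like \<open>l powr (-\<gamma>-1)\<close>.\<close>
  define N where "N = 2 * \<gamma> / \<alpha>"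
  define K where "K = N powr N"
  define L where "L = t powr (- 1 / \<alpha>)"
  have pos: "N > 0" "L > 0" "K > 0"
    using assms by (auto simp: N_def L_def K_def)
  have L: "L powr \<gamma> = t powr (- \<gamma> / \<alpha>)" "t powr (- N) = L powr (2 * \<gamma>)"
    by (simp_all add: L_def powr_powr N_def)
  have tail: "exp (- t * l powr \<alpha>) \<le> K * L powr (2 * \<gamma>) * l powr (- 2 * \<gamma>)" if "l > 0" for l
  proof -
    have "(t * l powr \<alpha>) powr N \<le> K * exp (t * l powr \<alpha>)"
      using powr_le_exp[of "t * l powr \<alpha>" N 1] assms pos by (simp add: K_def)
    moreover have "(t * l powr \<alpha>) powr N = t powr N * l powr (2 * \<gamma>)"
      using assms that by (simp add: powr_mult powr_powr N_def)
    ultimately have "t powr N * l powr (2 * \<gamma>) \<le> K * exp (t * l powr \<alpha>)"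
      by simp
    then have "exp (- t * l powr \<alpha>) \<le> K * t powr (- N) * l powr (- (2 * \<gamma>))"
      using assms that by (simp add: exp_minus powr_minus field_simps)
    then show ?thesis using L by simp
  qed
  have "(\<integral>\<^sup>+ l. ennreal (l powr (\<gamma> - 1)) * indicator {0..} l * ennreal (exp (- t * l powr \<alpha>)) \<partial>lborel)
     \<le> (\<integral>\<^sup>+ l. ennreal (l powr (\<gamma> - 1)) * indicator {0..L} l +
          ennreal (K * L powr (2 * \<gamma>)) * (ennreal (l powr (- \<gamma> - 1)) * indicator {L..} l) \<partial>lborel)"
  proof (intro nn_integral_mono)
    fix l :: real
    consider "l < 0" | "0 \<le> l" "l \<le> L" | "l > L" by linarith
    then show "ennreal (l powr (\<gamma> - 1)) * indicator {0..} l * ennreal (exp (- t * l powr \<alpha>))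
      \<le> ennreal (l powr (\<gamma> - 1)) * indicator {0..L} l +
          ennreal (K * L powr (2 * \<gamma>)) * (ennreal (l powr (- \<gamma> - 1)) * indicator {L..} l)"
    proof cases
      case 2
      have "l powr (\<gamma> - 1) * exp (- t * l powr \<alpha>) \<le> l powr (\<gamma> - 1)"
        using assms by (intro mult_right_le_one_le) auto
      with 2 show ?thesis
        by (auto simp: ennreal_mult[symmetric] intro!: add_increasing2 ennreal_leI)
    next
      case 3
      with pos have "l > 0" by simp
      have "l powr (\<gamma> - 1) * exp (- t * l powr \<alpha>)
          \<le> l powr (\<gamma> - 1) * (K * L powr (2 * \<gamma>) * l powr (- 2 * \<gamma>))"
        by (intro mult_left_mono tail \<open>l > 0\<close>) auto
      also have "\<dots> = K * L powr (2 * \<gamma>) * l powr (- \<gamma> - 1)"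
        by (simp add: powr_add[symmetric])
      finally show ?thesis
        using 3 \<open>l > 0\<close> pos by (auto simp: ennreal_mult[symmetric] intro!: ennreal_leI)
    qed auto
  qed
  also have "\<dots> = ennreal (L powr \<gamma> / \<gamma>) + ennreal (K * L powr (2 * \<gamma>)) * ennreal (L powr (- \<gamma>) / \<gamma>)"
    using pos assms
    by (simp add: nn_integral_add nn_integral_cmult nn_integral_powr_from_0 nn_integral_powr_to_inf)
  also have "\<dots> = ennreal (L powr \<gamma> / \<gamma> + K * (L powr (2 * \<gamma>) * L powr (- \<gamma>)) / \<gamma>)"
    using pos assms by (simp add: ennreal_mult[symmetric] ennreal_plus[symmetric] mult.assoc del: ennreal_plus)
  also have "L powr (2 * \<gamma>) * L powr (- \<gamma>) = L powr \<gamma>"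
    by (simp add: powr_add[symmetric])
  also have "L powr \<gamma> / \<gamma> + K * L powr \<gamma> / \<gamma> = (1 + K) / \<gamma> * t powr (- \<gamma> / \<alpha>)"
    unfolding L by (simp add: add_divide_distrib distrib_right)
  finally show ?thesis by (simp add: K_def N_def)
qed

text \<open>
  Writing \<open>s powr (-\<gamma>)\<close> as a superposition of exponentials \<open>exp (-l s)\<close> and exchanging the integrals
  leaves an integral of the Laplace transform over \<open>l\<close>.
\<close>
lemma subordination_negative_moment:
  assumes \<eta>: "subordination_density \<alpha> \<eta>" and "0 < \<alpha>" "0 < \<gamma>"
  shows "\<exists>c>0. \<forall>t>0. (\<integral>\<^sup>+ s. ennreal (s powr (- \<gamma>)) * (ennreal (\<eta> t s) * indicator {0<..} s) \<partial>lborel)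
           \<le> ennreal (c * t powr (- \<gamma> / \<alpha>))"
proof (intro exI conjI allI impI)
  define k where "k = (1 + (2 * \<gamma> / \<alpha>) powr (2 * \<gamma> / \<alpha>)) / \<gamma>"
  have "k > 0" using assms by (auto simp: k_def add_pos_nonneg)
  then show "exp 1 * \<gamma> * k > 0" using assms by auto
  fix t :: real assume "t > 0"
  note [measurable] = subordination_density_measurable[OF \<eta> \<open>t > 0\<close>]
  let ?w = "\<lambda>s. ennreal (\<eta> t s) * indicator {0<..} s"
  let ?g = "\<lambda>l. ennreal (l powr (\<gamma> - 1)) * indicator {0..} l"
  have "(\<integral>\<^sup>+ s. ennreal (s powr (- \<gamma>)) * ?w s \<partial>lborel)
     \<le> (\<integral>\<^sup>+ s. ennreal (exp 1 * \<gamma>) * (\<integral>\<^sup>+ l. ?g l * (ennreal (exp (- l * s)) * ?w s) \<partial>lborel) \<partial>lborel)"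
  proof (intro nn_integral_mono)
    fix s :: real
    show "ennreal (s powr (- \<gamma>)) * ?w s
       \<le> ennreal (exp 1 * \<gamma>) * (\<integral>\<^sup>+ l. ?g l * (ennreal (exp (- l * s)) * ?w s) \<partial>lborel)"
    proof (cases "s > 0")
      case True
      have "ennreal (s powr (- \<gamma>)) * ?w s
         \<le> ennreal (exp 1 * \<gamma>) * (\<integral>\<^sup>+ l. ?g l * ennreal (exp (- l * s)) \<partial>lborel) * ?w s"
        using True \<open>0 < \<gamma>\<close> by (intro mult_right_mono powr_minus_le_nn_integral_exp) auto
      also have "\<dots> = ennreal (exp 1 * \<gamma>) * (\<integral>\<^sup>+ l. ?g l * (ennreal (exp (- l * s)) * ?w s) \<partial>lborel)"
        by (subst mult.assoc, subst nn_integral_multc[symmetric]) (simp_all add: mult.assoc)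
      finally show ?thesis .
    qed auto
  qed
  also have "\<dots> = ennreal (exp 1 * \<gamma>) *
      (\<integral>\<^sup>+ s. (\<integral>\<^sup>+ l. ?g l * (ennreal (exp (- l * s)) * ?w s) \<partial>lborel) \<partial>lborel)"
    by (rule nn_integral_cmult) measurable
  also have "(\<integral>\<^sup>+ s. (\<integral>\<^sup>+ l. ?g l * (ennreal (exp (- l * s)) * ?w s) \<partial>lborel) \<partial>lborel)
     = (\<integral>\<^sup>+ l. (\<integral>\<^sup>+ s. ?g l * (ennreal (exp (- l * s)) * ?w s) \<partial>lborel) \<partial>lborel)"
    by (rule lborel_pair.Fubini') measurable
  also have "\<dots> = (\<integral>\<^sup>+ l. ?g l * ennreal (exp (- t * l powr \<alpha>)) \<partial>lborel)"
  proof (intro nn_integral_cong)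
    fix l :: real
    have "(\<integral>\<^sup>+ s. ?g l * (ennreal (exp (- l * s)) * ?w s) \<partial>lborel)
       = ?g l * (\<integral>\<^sup>+ s. ennreal (exp (- l * s)) * ?w s \<partial>lborel)"
      by (rule nn_integral_cmult) measurable
    also have "\<dots> = ?g l * ennreal (exp (- t * l powr \<alpha>))"
      by (cases "l \<ge> 0") (use subordination_laplace[OF \<eta> \<open>t > 0\<close>, of l] in auto)
    finally show "(\<integral>\<^sup>+ s. ?g l * (ennreal (exp (- l * s)) * ?w s) \<partial>lborel)
       = ?g l * ennreal (exp (- t * l powr \<alpha>))" .
  qed
  also have "\<dots> \<le> ennreal (k * t powr (- \<gamma> / \<alpha>))"
    unfolding k_def by (rule nn_integral_powr_exp_powr_le) fact+
  finally show "(\<integral>\<^sup>+ s. ennreal (s powr (- \<gamma>)) * ?w s \<partial>lborel) \<le> ennreal (exp 1 * \<gamma> * k * t powr (- \<gamma> / \<alpha>))"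
    using \<open>k > 0\<close> \<open>0 < \<gamma>\<close>
    by (simp add: ennreal_mult[symmetric] mult.assoc mult_left_mono)
qed

section \<open>The heat kernel bounds\<close>

text \<open>
  With \<open>u = D/s\<close> the claim becomes \<open>u\<^sup>a * exp (-C u) \<le> K * (1 - exp (-1/u))\<close>. Since
  \<open>1 - exp (-1/u) \<ge> 1/(1+u)\<close>, it suffices that \<open>u\<^sup>a * (1+u)\<close> grows more slowly than \<open>exp (C u)\<close>.
\<close>
lemma gaussian_le_one_minus_exp:
  fixes a C :: real
  assumes "a > 0" "C > 0"
  shows "\<exists>K>0. \<forall>s>0. \<forall>D>0. s powr (- a) * exp (- C * D / s) \<le> K * D powr (- a) * (1 - exp (- (1 / D) * s))"
proof (intro exI conjI allI impI)
  define K where "K = ((a + 1) / C) powr (a + 1) * exp C"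
  show "K > 0" using assms by (simp add: K_def)
  fix s D :: real assume "s > 0" "D > 0"
  define u where "u = D / s"
  have "u > 0" using \<open>s > 0\<close> \<open>D > 0\<close> by (simp add: u_def)
  have "u powr a * (1 + u) \<le> (1 + u) powr a * (1 + u)"
    using \<open>u > 0\<close> assms by (intro mult_right_mono powr_mono2) auto
  also have "\<dots> = (1 + u) powr (a + 1)"
    using \<open>u > 0\<close> by (simp add: powr_add)
  also have "\<dots> \<le> ((a + 1) / C) powr (a + 1) * exp (C * (1 + u))"
    using \<open>u > 0\<close> assms by (intro powr_le_exp) auto
  also have "\<dots> = K * exp (C * u)"
    by (simp add: K_def distrib_left exp_add)
  finally have 1: "u powr a * exp (- C * u) \<le> K * (1 / (1 + u))"
    using \<open>u > 0\<close> by (simp add: exp_minus field_simps)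
  have "1 + 1 / u \<le> exp (1 / u)"
    by (rule exp_ge_add_one_self)
  then have "1 / exp (1 / u) \<le> 1 / (1 + 1 / u)"
    using \<open>u > 0\<close> by (intro divide_left_mono) (auto simp: add_pos_pos)
  then have 2: "1 / (1 + u) \<le> 1 - exp (- (1 / u))"
    using \<open>u > 0\<close> by (simp add: exp_minus field_simps)
  have "s powr (- a) * exp (- C * D / s) = D powr (- a) * (u powr a * exp (- C * u))"
    using \<open>s > 0\<close> \<open>D > 0\<close> by (simp add: u_def powr_divide powr_minus field_simps)
  also have "\<dots> \<le> D powr (- a) * (K * (1 - exp (- (1 / u))))"
    using 1 mult_left_mono[OF 2, of K] \<open>K > 0\<close> by (intro mult_left_mono) auto
  also have "\<dots> = K * D powr (- a) * (1 - exp (- (1 / D) * s))"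
    by (simp add: u_def)
  finally show "s powr (- a) * exp (- C * D / s) \<le> K * D powr (- a) * (1 - exp (- (1 / D) * s))" .
qed

lemma heat_kernel_le_gaussian:
  fixes M :: "'a::metric_space measure"
  assumes upper: "\<And>s x y. s > 0 \<Longrightarrow> ennreal (p s x y) \<le>
             ennreal c * (1 / emeasure M (ball x (sqrt s))) * ennreal (exp (- C * (dist x y)\<^sup>2 / s))"
    and "c > 0"
    and lower: "0 < (INF (x, r) \<in> UNIV \<times> {0<..}. emeasure M (ball x r) / ennreal (r powr \<beta>))"
  shows "\<exists>A>0. \<forall>s>0. \<forall>x y. p s x y \<le> A * (s powr (- (\<beta> / 2)) * exp (- C * (dist x y)\<^sup>2 / s))"
proof -
  \<comment> \<open>The infimum may be \<open>\<infinity>\<close>, when every ball has infinite measure; a positive real below it works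
      in all cases.\<close>
  obtain k' where k': "0 < k'"
      "k' < (INF (x, r) \<in> UNIV \<times> {0<..}. emeasure M (ball x r) / ennreal (r powr \<beta>))"
    using dense[OF lower] by blast
  then have "k' < top"
    using top.not_eq_extremum by fastforce
  then obtain k where "k' = ennreal k"
    by (cases k') auto
  with k' have k: "0 < ennreal k"
      "ennreal k < (INF (x, r) \<in> UNIV \<times> {0<..}. emeasure M (ball x r) / ennreal (r powr \<beta>))"
    by simp_all
  then have "k > 0" by simp
  show ?thesis
  proof (intro exI[of _ "c / k"] conjI allI impI)
    show "c / k > 0" using \<open>k > 0\<close> \<open>c > 0\<close> by simp
    fix s :: real and x y :: 'a assume "s > 0"
    have "ennreal k \<le> emeasure M (ball x (sqrt s)) / ennreal (sqrt s powr \<beta>)"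
      using less_INF_D[OF k(2), of "(x, sqrt s)"] \<open>s > 0\<close> by simp
    then have "ennreal k * ennreal (sqrt s powr \<beta>)
        \<le> emeasure M (ball x (sqrt s)) / ennreal (sqrt s powr \<beta>) * ennreal (sqrt s powr \<beta>)"
      by (rule mult_right_mono) simp
    also have "\<dots> = emeasure M (ball x (sqrt s))"
      using \<open>s > 0\<close> by (simp add: ennreal_divide_times)
    also have "sqrt s powr \<beta> = s powr (\<beta> / 2)"
      using \<open>s > 0\<close> by (simp add: powr_half_sqrt[symmetric] powr_powr)
    finally have "ennreal (k * s powr (\<beta> / 2)) \<le> emeasure M (ball x (sqrt s))"
      using \<open>k > 0\<close> by (simp add: ennreal_mult)
    then have "1 / emeasure M (ball x (sqrt s)) \<le> 1 / ennreal (k * s powr (\<beta> / 2))"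
      by (simp add: divide_ennreal_def ennreal_inverse_antimono)
    also have "\<dots> = ennreal (1 / (k * s powr (\<beta> / 2)))"
      using \<open>k > 0\<close> \<open>s > 0\<close> by (subst ennreal_1[symmetric], subst divide_ennreal) auto
    finally have "ennreal (p s x y) \<le> ennreal c * ennreal (1 / (k * s powr (\<beta> / 2)))
         * ennreal (exp (- C * (dist x y)\<^sup>2 / s))"
      by (intro order.trans[OF upper[OF \<open>s > 0\<close>]] mult_right_mono mult_left_mono) auto
    also have "\<dots> = ennreal (c / k * (s powr (- (\<beta> / 2)) * exp (- C * (dist x y)\<^sup>2 / s)))"
      using \<open>c > 0\<close> \<open>k > 0\<close> by (simp add: ennreal_mult[symmetric] powr_minus field_simps)
    finally show "p s x y \<le> c / k * (s powr (- (\<beta> / 2)) * exp (- C * (dist x y)\<^sup>2 / s))"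
      using \<open>c > 0\<close> \<open>k > 0\<close> by (subst (asm) ennreal_le_iff) auto
  qed
qed

lemma fractional_heat_kernel_le:
  assumes \<eta>: "subordination_density \<alpha> \<eta>" and "t > 0"
    and "\<And>s. s > 0 \<Longrightarrow> p s x y \<le> B * g s" and "B \<ge> 0" and "\<And>s. s > 0 \<Longrightarrow> g s \<ge> 0"
    and [measurable]: "g \<in> borel_measurable borel"
  shows "fractional_heat_kernel \<eta> p t x y
       \<le> ennreal B * (\<integral>\<^sup>+ s. ennreal (g s) * (ennreal (\<eta> t s) * indicator {0<..} s) \<partial>lborel)"
proof -
  note [measurable] = subordination_density_measurable[OF \<eta> \<open>t > 0\<close>]
  have "fractional_heat_kernel \<eta> p t x y
      \<le> (\<integral>\<^sup>+ s. ennreal B * (ennreal (g s) * (ennreal (\<eta> t s) * indicator {0<..} s)) \<partial>lborel)"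
    unfolding fractional_heat_kernel_def
  proof (intro nn_integral_mono)
    fix s :: real
    show "ennreal (\<eta> t s * p s x y) * indicator {0<..} s
       \<le> ennreal B * (ennreal (g s) * (ennreal (\<eta> t s) * indicator {0<..} s))"
    proof (cases "s > 0")
      case True
      have "\<eta> t s \<ge> 0"
        using \<eta> \<open>t > 0\<close> True by (auto simp: subordination_density_def)
      then have "\<eta> t s * p s x y \<le> B * (g s * \<eta> t s)"
        using mult_left_mono[OF assms(3)[OF True], of "\<eta> t s"] by (simp add: ac_simps)
      then show ?thesis
        using True \<open>\<eta> t s \<ge> 0\<close> \<open>B \<ge> 0\<close> assms(5)[OF True]
        by (simp add: ennreal_mult[symmetric] ennreal_leI)
    qed auto
  qed
  also have "\<dots> = ennreal B * (\<integral>\<^sup>+ s. ennreal (g s) * (ennreal (\<eta> t s) * indicator {0<..} s) \<partial>lborel)"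
    by (rule nn_integral_cmult) measurable
  finally show ?thesis .
qed

text \<open>
  The diagonal bound is the negative moment of order \<open>\<beta>/2\<close>; the off-diagonal bound is the Laplace
  transform estimate at \<open>l = 1/d\<^sup>2\<close>, multiplied by the scaling factor \<open>d powr (-\<beta>)\<close>.
\<close>
lemma fractional_heat_kernel_le_min_bound:
  fixes M :: "'a::metric_space measure"
  assumes \<eta>: "subordination_density \<alpha> \<eta>" and "0 < \<alpha>" and "0 < \<beta>" and "0 < C"
    and upper: "\<exists>c>0. \<forall>s>0. \<forall>x y. 0 < p s x y \<and>
           ennreal (p s x y) \<le>
             ennreal c * (1 / emeasure M (ball x (sqrt s))) * ennreal (exp (- C * (dist x y)\<^sup>2 / s))"
    and lower: "0 < (INF (x, r) \<in> UNIV \<times> {0<..}. emeasure M (ball x r) / ennreal (r powr \<beta>))"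
  shows "\<exists>c>0. \<forall>t>0. \<forall>x y.
           fractional_heat_kernel \<eta> p t x y \<le> ennreal c * fractional_min_bound \<alpha> \<beta> t x y"
proof -
  from upper obtain c where "c > 0" and upper': "\<And>s x y. s > 0 \<Longrightarrow> ennreal (p s x y) \<le>
      ennreal c * (1 / emeasure M (ball x (sqrt s))) * ennreal (exp (- C * (dist x y)\<^sup>2 / s))"
    by blast
  obtain A where "A > 0" and A: "\<And>s x y. s > 0 \<Longrightarrow>
      p s x y \<le> A * (s powr (- (\<beta> / 2)) * exp (- C * (dist x y)\<^sup>2 / s))"
    using heat_kernel_le_gaussian[where p = p, OF upper' \<open>c > 0\<close> lower] by blast
  obtain c1 where "c1 > 0" and c1: "\<And>t. t > 0 \<Longrightarrow>
      (\<integral>\<^sup>+ s. ennreal (s powr (- (\<beta> / 2))) * (ennreal (\<eta> t s) * indicator {0<..} s) \<partial>lborel)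
        \<le> ennreal (c1 * t powr (- (\<beta> / 2) / \<alpha>))"
    using subordination_negative_moment[OF \<eta> \<open>0 < \<alpha>\<close>, of "\<beta> / 2"] \<open>0 < \<beta>\<close>
    by auto
  obtain K where "K > 0" and K: "\<And>s D. s > 0 \<Longrightarrow> D > 0 \<Longrightarrow>
      s powr (- (\<beta> / 2)) * exp (- C * D / s) \<le> K * D powr (- (\<beta> / 2)) * (1 - exp (- (1 / D) * s))"
    using gaussian_le_one_minus_exp[of "\<beta> / 2" C] \<open>0 < \<beta>\<close> \<open>0 < C\<close> by auto
  have diag: "fractional_heat_kernel \<eta> p t x y \<le> ennreal (A * c1) * ennreal (t powr (- \<beta> / (2 * \<alpha>)))"
    if "t > 0" for t x y
  proof -
    have p_le: "p s x y \<le> A * s powr (- (\<beta> / 2))" if "s > 0" for s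
    proof -
      have "s powr (- (\<beta> / 2)) * exp (- C * (dist x y)\<^sup>2 / s) \<le> s powr (- (\<beta> / 2))"
        using that \<open>0 < C\<close> by (intro mult_right_le_one_le) auto
      then show ?thesis
        using A[OF that, of x y] \<open>A > 0\<close> by (meson mult_left_mono less_imp_le order_trans)
    qed
    have "fractional_heat_kernel \<eta> p t x y
        \<le> ennreal A * (\<integral>\<^sup>+ s. ennreal (s powr (- (\<beta> / 2))) * (ennreal (\<eta> t s) * indicator {0<..} s) \<partial>lborel)"
      using \<open>A > 0\<close> by (intro fractional_heat_kernel_le[OF \<eta> that] p_le) auto
    also have "\<dots> \<le> ennreal A * ennreal (c1 * t powr (- (\<beta> / 2) / \<alpha>))"
      by (intro mult_left_mono c1 that) auto
    also have "\<dots> = ennreal (A * c1) * ennreal (t powr (- \<beta> / (2 * \<alpha>)))"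
      using \<open>A > 0\<close> \<open>c1 > 0\<close> by (simp add: ennreal_mult[symmetric] mult.assoc)
    finally show ?thesis .
  qed
  have off_diag: "fractional_heat_kernel \<eta> p t x y
      \<le> ennreal (A * K) * ennreal (t / dist x y powr (\<beta> + 2 * \<alpha>))"
    if "t > 0" "x \<noteq> y" for t x y
  proof -
    define d where "d = dist x y"
    have "d > 0" using \<open>x \<noteq> y\<close> by (simp add: d_def)
    have sq: "(d\<^sup>2) powr a = d powr (2 * a)" for a
      using \<open>d > 0\<close> by (simp add: powr_powr flip: powr_numeral)
    have p_le: "p s x y \<le> A * K * d powr (- \<beta>) * (1 - exp (- (1 / d\<^sup>2) * s))" if "s > 0" for s
    proof -
      have "p s x y \<le> A * (K * (d\<^sup>2) powr (- (\<beta> / 2)) * (1 - exp (- (1 / d\<^sup>2) * s)))"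
        using \<open>A > 0\<close> \<open>d > 0\<close> K[OF that, of "d\<^sup>2"]
        by (intro order.trans[OF A[OF that, of x y]] mult_left_mono) (simp_all add: d_def)
      then show ?thesis by (simp add: sq mult.assoc)
    qed
    have "fractional_heat_kernel \<eta> p t x y \<le> ennreal (A * K * d powr (- \<beta>)) *
        (\<integral>\<^sup>+ s. ennreal (1 - exp (- (1 / d\<^sup>2) * s)) * (ennreal (\<eta> t s) * indicator {0<..} s) \<partial>lborel)"
      using \<open>A > 0\<close> \<open>K > 0\<close> \<open>d > 0\<close>
      by (intro fractional_heat_kernel_le[OF \<eta> that(1)] p_le) auto
    also have "\<dots> \<le> ennreal (A * K * d powr (- \<beta>)) * ennreal (t * (1 / d\<^sup>2) powr \<alpha>)"
      using \<open>t > 0\<close>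
      by (intro mult_left_mono subordination_one_minus_laplace_le \<eta>) auto
    also have "\<dots> = ennreal (A * K * d powr (- \<beta>) * (t * (1 / d\<^sup>2) powr \<alpha>))"
      using \<open>A > 0\<close> \<open>K > 0\<close> \<open>t > 0\<close> by (intro ennreal_mult[symmetric]) auto
    also have "A * K * d powr (- \<beta>) * (t * (1 / d\<^sup>2) powr \<alpha>) = A * K * (t / d powr (\<beta> + 2 * \<alpha>))"
      by (simp add: powr_divide sq powr_add powr_minus divide_simps)
    also have "ennreal \<dots> = ennreal (A * K) * ennreal (t / d powr (\<beta> + 2 * \<alpha>))"
      using \<open>A > 0\<close> \<open>K > 0\<close> \<open>t > 0\<close> by (intro ennreal_mult) auto
    finally show ?thesis by (simp add: d_def)
  qed
  have min_bound: "fractional_heat_kernel \<eta> p t x y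
      \<le> ennreal (A * c1 + A * K) * fractional_min_bound \<alpha> \<beta> t x y" if "t > 0" for t x y
  proof -
    have le1: "ennreal (A * c1) \<le> ennreal (A * c1 + A * K)" and le2: "ennreal (A * K) \<le> ennreal (A * c1 + A * K)"
      using \<open>A > 0\<close> \<open>K > 0\<close> \<open>c1 > 0\<close> by (auto intro!: ennreal_leI)
    have 1: "fractional_heat_kernel \<eta> p t x y \<le> ennreal (A * c1 + A * K) * ennreal (t powr (- \<beta> / (2 * \<alpha>)))"
      using diag[OF that, of x y] mult_right_mono[OF le1] by (meson order_trans zero_le)
    have 2: "fractional_heat_kernel \<eta> p t x y
        \<le> ennreal (A * c1 + A * K) * (ennreal t / ennreal (dist x y powr (\<beta> + 2 * \<alpha>)))"
      \<comment> \<open>On the diagonal the right-hand side is \<open>\<infinity>\<close>.\<close>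
    proof (cases "x = y")
      case True
      have "A * c1 + A * K > 0"
        using \<open>A > 0\<close> \<open>K > 0\<close> \<open>c1 > 0\<close> by (simp add: add_pos_pos)
      with True \<open>t > 0\<close> show ?thesis by (simp add: ennreal_mult_top)
    next
      case False
      have "fractional_heat_kernel \<eta> p t x y
          \<le> ennreal (A * c1 + A * K) * ennreal (t / dist x y powr (\<beta> + 2 * \<alpha>))"
        using off_diag[OF that False] mult_right_mono[OF le2] by (meson order_trans zero_le)
      then show ?thesis using False \<open>t > 0\<close> by (simp add: divide_ennreal)
    qed
    show ?thesis
      unfolding fractional_min_bound_def using 1 2 by (auto simp: min_def)
  qed
  have "A * c1 + A * K > 0"
    using \<open>A > 0\<close> \<open>K > 0\<close> \<open>c1 > 0\<close> by (simp add: add_pos_pos)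
  then show ?thesis
    using min_bound by blast
qed

text \<open>
  The entry of the minimum that belongs to the larger of \<open>t powr (1/2\<alpha>)\<close> and \<open>dist x y\<close> is already
  small enough; choosing the first one when \<open>x = y\<close> avoids the infinite value of the second.
\<close>
lemma fractional_min_bound_le:
  assumes "0 < \<alpha>" "0 < \<beta>"
  shows "\<exists>c>0. \<forall>t>0. \<forall>x y :: 'a::metric_space. fractional_min_bound \<alpha> \<beta> t x y
           \<le> ennreal c * ennreal (t / (t powr (1 / (2 * \<alpha>)) + dist x y) powr (\<beta> + 2 * \<alpha>))"
proof (intro exI[of _ "2 powr (\<beta> + 2 * \<alpha>)"] conjI allI impI)
  fix t :: real and x y :: 'a assume "t > 0"
  define e where "e = \<beta> + 2 * \<alpha>"
  define T where "T = t powr (1 / (2 * \<alpha>))"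
  have "e > 0" "T > 0" using assms \<open>t > 0\<close> by (auto simp: e_def T_def)
  have bound: "t / m powr e \<le> 2 powr e * (t / (T + dist x y) powr e)"
    if "m > 0" "T + dist x y \<le> 2 * m" for m
  proof -
    have "(T + dist x y) powr e \<le> (2 * m) powr e"
      using that \<open>e > 0\<close> \<open>T > 0\<close> by (intro powr_mono2) auto
    then have "(T + dist x y) powr e \<le> 2 powr e * m powr e"
      using that by (simp add: powr_mult)
    moreover have "T + dist x y > 0"
      using \<open>T > 0\<close> by (simp add: add_pos_nonneg)
    ultimately show ?thesis
      using that \<open>t > 0\<close> by (simp add: field_simps)
  qed
  have "fractional_min_bound \<alpha> \<beta> t x y \<le> ennreal (2 powr e * (t / (T + dist x y) powr e))"
  proof (cases "dist x y \<le> T")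
    case True
    have "t powr (- \<beta> / (2 * \<alpha>)) = t / T powr e"
      using assms \<open>t > 0\<close> by (simp add: T_def e_def powr_powr powr_diff[symmetric] add_divide_distrib powr_add
          powr_minus divide_simps)
    then show ?thesis
      using bound[of T] True \<open>T > 0\<close>
      by (auto simp: fractional_min_bound_def intro!: min.coboundedI1 ennreal_leI)
  next
    case False
    with \<open>T > 0\<close> have "dist x y > 0" by linarith
    then have "ennreal t / ennreal (dist x y powr e) = ennreal (t / dist x y powr e)"
      using \<open>t > 0\<close> by (intro divide_ennreal) auto
    then show ?thesis
      using bound[of "dist x y"] False \<open>dist x y > 0\<close>
      by (auto simp: fractional_min_bound_def e_def[symmetric] intro!: min.coboundedI2 ennreal_leI)
  qed
  then show "fractional_min_bound \<alpha> \<beta> t x y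
      \<le> ennreal (2 powr (\<beta> + 2 * \<alpha>)) * ennreal (t / (t powr (1 / (2 * \<alpha>)) + dist x y) powr (\<beta> + 2 * \<alpha>))"
    using \<open>t > 0\<close> by (simp add: ennreal_mult[symmetric] e_def T_def)
qed simp

theorem proposition2p8:
  fixes M :: "'a::metric_space measure"
    and p :: "real \<Rightarrow> 'a \<Rightarrow> 'a \<Rightarrow> real"
    and \<eta> :: "real \<Rightarrow> real \<Rightarrow> real"
    and \<alpha> \<beta> C :: real
  assumes "heat_kernel M p"
    and "0 < \<alpha>" and "\<alpha> < 1"
    and "subordination_density \<alpha> \<eta>"
    and "0 < \<beta>" and "ennreal \<beta> \<le> hausdorff_dim (UNIV :: 'a set)"
    and "0 < C"
    and "\<exists>c>0. \<forall>s>0. \<forall>x y. 0 < p s x y \<and>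
           ennreal (p s x y) \<le>
             ennreal c * (1 / emeasure M (ball x (sqrt s))) * ennreal (exp (- C * (dist x y)\<^sup>2 / s))"
    and "0 < (INF (x, r) \<in> UNIV \<times> {0<..}. emeasure M (ball x r) / ennreal (r powr \<beta>))"
  shows "(\<exists>c>0. \<forall>t>0. \<forall>x y.
            fractional_heat_kernel \<eta> p t x y \<le> ennreal c * fractional_min_bound \<alpha> \<beta> t x y) \<and>
         (\<exists>c>0. \<forall>t>0. \<forall>x y :: 'a.
            fractional_min_bound \<alpha> \<beta> t x y
              \<le> ennreal c * ennreal (t / (t powr (1 / (2 * \<alpha>)) + dist x y) powr (\<beta> + 2 * \<alpha>)))"
  by (rule conjI[OF fractional_heat_kernel_le_min_bound[OF assms(4,2,5,7,8,9)]
        fractional_min_bound_le[OF assms(2,5)]])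

end
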